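(* Let $X$ be a visual Gromov hyperbolic metric space and let $\omega\in\partial_GX$. Equip the Gromov boundary $\partial_\omega X$ of $X$ relative to $\omega$ with a visual metric based at $\omega$ (with any parameter $\varepsilon>0$ for which one exists), and assume that $\partial_\omega X$ has at least three points. Then $X$ and the infinite hyperbolic cone $\mathrm{Con}_h(\partial_\omega X)$ are roughly similar.
   Context: Gromov hyperbolicity: in a metric space $(X,d_X)$, $(x|y)_o=\frac12(d_X(x,o)+d_X(y,o)-d_X(x,y))$; $X$ is Gromov $\delta$-hyperbolic if $(x|y)_o\ge\min\{(x|z)_o,(z|y)_o\}-\delta$ for all $x,y,z,o\in X$, and Gromov hyperbolic if this holds for some $\delta\ge0$. Visual: a $k$-roughly geodesic ray emanating from $o$ is a map $\gamma:[0,\infty)\to X$ with $\gamma(0)=o$ and $|s-t|-k\le d_X(\gamma(s),\gamma(t))\le|s-t|+k$ for all $s,t\ge0$. $X$ is visual if there are $k\ge0$ and $o\in X$ such that each point of $X$ lies on a $k$-roughly geodesic ray emanating from $o$. Gromov boundary: a sequence $\{x_i\}$ in $X$ converges to infinity if $(x_i|x_j)_o\to\infty$ as $i,j\to\infty$; two such sequences $\{x_i\},\{y_i\}$ are equivalent if $(x_i|y_i)_o\to\infty$ (independent of $o\in X$). $\partial_GX$ is the set of equivalence classes; $\{x_i\}\in\xi$ means that $\{x_i\}$ belongs to the class $\xi$. For $\xi\in\partial_GX$, $y\in X$: $(\xi|y)_o=(y|\xi)_o=\inf\{\liminf_i(x_i|y)_o:\{x_i\}\in\xi\}$. Busemann functions: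 for $\omega\in\partial_GX$ and $o\in X$, $b_{\omega,o}(x)=(\omega|o)_x-(\omega|x)_o$. $\mathcal B(\omega)$ is the set of functions $b:X\to\mathbb R$ for which there are $o'\in X$ and $c\in\mathbb R$ with $|b(x)-b_{\omega,o'}(x)|\le c$ for all $x\in X$. For $b\in\mathcal B(\omega)$ and $x,y\in X$, $(x|y)_b=\frac12(b(x)+b(y)-d_X(x,y))$; for $\zeta,\xi\in\partial_GX\setminus\{\omega\}$, $(\zeta|\xi)_b=\inf\{\liminf_i(x_i|y_i)_b:\{x_i\}\in\zeta,\{y_i\}\in\xi\}$. Gromov boundary relative to $\omega$: fix $b\in\mathcal B(\omega)$. A sequence $\{x_n\}$ converges to infinity with respect to $\omega$ if $(x_m|x_n)_b\to\infty$ as $m,n\to\infty$; two such sequences are equivalent if $(x_n|y_n)_b\to\infty$. These notions do not depend on $b\in\mathcal B(\omega)$. $\partial_\omega X$ is the set of equivalence classes. It is known that a sequence converges to infinity with respect to $\omega$ if and only if it converges to some $\xi\in\partial_GX\setminus\{\omega\}$, and this gives an identification $\partial_\omega X=\partial_GX\setminus\{\omega\}$, which is used throughout. Visual metric: a metric $d$ on $\partial_\omega X$ is a visual metric based at $\omega$ with parameter $\varepsilon>0$ if for some (equivalently every) $b\in\mathcal B(\omega)$ there is a constant $C\ge1$ with $C^{-1}e^{-\varepsilon(\zeta|\xi)_b}\le d(\zeta,\xi)\le Ce^{-\varepsilon(\zeta|\xi)_b}$ for all $\zeta,\xi\in\partial_\omega X$ (with $e^{-\infty}=0$). Visual metrics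 exist for all sufficiently small $\varepsilon>0$. Infinite hyperbolic cone of a metric space $(Z,d_Z)$: $\mathrm{Con}_h(Z)=Z\times(0,\infty)$ with the metric $\rho_h((x,s),(y,t))=2\log\left(\frac{d_Z(x,y)+\max\{s,t\}}{\sqrt{st}}\right)$. Roughly similar: metric spaces $(X,d_X)$ and $(Y,d_Y)$ are roughly similar if there are $\alpha>0$, $k\ge0$ and a map $g:X\to Y$ such that every point of $Y$ has distance at most $k$ from $g(X)$ and $\alpha d_X(x,z)-k\le d_Y(g(x),g(z))\le\alpha d_X(x,z)+k$ for all $x,z\in X$. *)

theory Defs
  imports "HOL-Analysis.Analysis"
begin

section \<open>Gromov hyperbolic and visual metric spaces\<close>

text \<open>
  The base point is the first argument throughout: \<open>gromov_product p x y\<close> is $(x|y)_p$.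
\<close>

definition gromov_product :: "'a::metric_space \<Rightarrow> 'a \<Rightarrow> 'a \<Rightarrow> real" where
  "gromov_product p x y = (dist x p + dist y p - dist x y) / 2"

definition gromov_hyperbolic :: "'a::metric_space itself \<Rightarrow> bool" where
  "gromov_hyperbolic (_ :: 'a itself) \<longleftrightarrow>
     (\<exists>\<delta>\<ge>0. \<forall>x y z p :: 'a.
        gromov_product p x y \<ge> min (gromov_product p x z) (gromov_product p z y) - \<delta>)"

text \<open>Only the values of \<open>\<gamma>\<close> on $[0,\infty)$ matter.\<close>

definition roughly_geodesic_ray :: "real \<Rightarrow> 'a::metric_space \<Rightarrow> (real \<Rightarrow> 'a) \<Rightarrow> bool" where
  "roughly_geodesic_ray k p \<gamma> \<longleftrightarrow>
     \<gamma> 0 = p \<and>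
     (\<forall>s\<ge>0. \<forall>t\<ge>0. \<bar>s - t\<bar> - k \<le> dist (\<gamma> s) (\<gamma> t) \<and> dist (\<gamma> s) (\<gamma> t) \<le> \<bar>s - t\<bar> + k)"

definition visual_space :: "'a::metric_space itself \<Rightarrow> bool" where
  "visual_space (_ :: 'a itself) \<longleftrightarrow>
     (\<exists>k\<ge>0. \<exists>p :: 'a. \<forall>x. \<exists>\<gamma>. roughly_geodesic_ray k p \<gamma> \<and> x \<in> \<gamma> ` {0..})"

section \<open>The Gromov boundary\<close>

text \<open>
  The choice of base point is immaterial, see \<open>gromov_product_at_top_base\<close> below; quantifying over
  all base points makes the notions independent of it by definition.
\<close>

definition converges_to_infinity :: "(nat \<Rightarrow> 'a::metric_space) \<Rightarrow> bool" where
  "converges_to_infinity x \<longleftrightarrow>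
     (\<forall>p. filterlim (\<lambda>(i, j). gromov_product p (x i) (x j)) at_top
            (sequentially \<times>\<^sub>F sequentially))"

definition boundary_equiv :: "((nat \<Rightarrow> 'a::metric_space) \<times> (nat \<Rightarrow> 'a)) set" where
  "boundary_equiv =
     {(x, y). converges_to_infinity x \<and> converges_to_infinity y \<and>
              (\<forall>p. filterlim (\<lambda>i. gromov_product p (x i) (y i)) at_top sequentially)}"

definition gromov_boundary :: "(nat \<Rightarrow> 'a::metric_space) set set" where
  "gromov_boundary = {x. converges_to_infinity x} // boundary_equiv"

lemma gromov_product_base_change:
  "gromov_product p x y - dist p q \<le> gromov_product q x y"
  using dist_triangle[of x p q] dist_triangle[of y p q]
  by (simp add: gromov_product_def dist_commute field_simps)

lemma gromov_product_at_top_base: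
  assumes "filterlim (\<lambda>t. gromov_product p (f t) (g t)) at_top F"
  shows "filterlim (\<lambda>t. gromov_product q (f t) (g t)) at_top F"
proof (rule filterlim_at_top_mono)
  show "filterlim (\<lambda>t. - dist p q + gromov_product p (f t) (g t)) at_top F"
    by (rule filterlim_tendsto_add_at_top[OF tendsto_const assms])
  show "\<forall>\<^sub>F t in F. - dist p q + gromov_product p (f t) (g t) \<le> gromov_product q (f t) (g t)"
    using gromov_product_base_change[of p _ _ q] by (intro always_eventually) (simp add: algebra_simps)
qed

section \<open>Busemann functions\<close>

text \<open>$(\xi|y)_p$ for a boundary point $\xi$ and a point $y$ of the space.\<close>

definition boundary_product :: "'a::metric_space \<Rightarrow> (nat \<Rightarrow> 'a) set \<Rightarrow> 'a \<Rightarrow> ereal" where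
  "boundary_product p \<xi> y = (INF x\<in>\<xi>. liminf (\<lambda>i. ereal (gromov_product p (x i) y)))"

text \<open>$(\xi|y)_p$ is finite, so that taking its real part below loses nothing.\<close>

lemma boundary_product_finite:
  assumes "\<xi> \<noteq> {}"
  shows "0 \<le> boundary_product p \<xi> y" "boundary_product p \<xi> y \<le> ereal (dist y p)"
proof -
  have ge: "0 \<le> gromov_product p z y" for z
    using dist_triangle[of z y p] by (simp add: gromov_product_def dist_commute)
  have le: "gromov_product p z y \<le> dist y p" for z
    using dist_triangle[of z p y] by (simp add: gromov_product_def dist_commute)
  show "0 \<le> boundary_product p \<xi> y"
    unfolding boundary_product_def
    by (intro INF_greatest Liminf_bounded always_eventually) (simp add: ge)
  obtain x where x: "x \<in> \<xi>" using assms by blast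
  have "liminf (\<lambda>i. ereal (gromov_product p (x i) y)) \<le> liminf (\<lambda>i. ereal (dist y p))"
    by (intro Liminf_mono always_eventually) (simp add: le)
  then show "boundary_product p \<xi> y \<le> ereal (dist y p)"
    unfolding boundary_product_def by (intro INF_lower2[OF x]) (simp add: Liminf_const)
qed

definition busemann :: "(nat \<Rightarrow> 'a::metric_space) set \<Rightarrow> 'a \<Rightarrow> 'a \<Rightarrow> real" where
  "busemann \<omega> p x =
     real_of_ereal (boundary_product x \<omega> p) - real_of_ereal (boundary_product p \<omega> x)"

definition busemann_functions :: "(nat \<Rightarrow> 'a::metric_space) set \<Rightarrow> ('a \<Rightarrow> real) set" where
  "busemann_functions \<omega> = {b. \<exists>p c. \<forall>x. \<bar>b x - busemann \<omega> p x\<bar> \<le> c}"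

definition product_wrt :: "('a::metric_space \<Rightarrow> real) \<Rightarrow> 'a \<Rightarrow> 'a \<Rightarrow> real" where
  "product_wrt b x y = (b x + b y - dist x y) / 2"

definition boundary_product_wrt ::
  "('a::metric_space \<Rightarrow> real) \<Rightarrow> (nat \<Rightarrow> 'a) set \<Rightarrow> (nat \<Rightarrow> 'a) set \<Rightarrow> ereal" where
  "boundary_product_wrt b \<zeta> \<xi> =
     (INF x\<in>\<zeta>. INF y\<in>\<xi>. liminf (\<lambda>i. ereal (product_wrt b (x i) (y i))))"

section \<open>The Gromov boundary relative to a boundary point\<close>

text \<open>
  In a hyperbolic space the choice of the function in \<open>busemann_functions \<omega>\<close> is immaterial.
  Elements of \<open>relative_boundary \<omega>\<close> are, like those of \<^const>\<open>gromov_boundary\<close>, sets of sequences,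
  so the identification $\partial_\omega X = \partial_G X \setminus \{\omega\}$ is an equality of
  sets and \<^const>\<open>boundary_product_wrt\<close> applies to both.
\<close>

definition converges_to_infinity_wrt ::
  "(nat \<Rightarrow> 'a::metric_space) set \<Rightarrow> (nat \<Rightarrow> 'a) \<Rightarrow> bool" where
  "converges_to_infinity_wrt \<omega> x \<longleftrightarrow>
     (\<forall>b\<in>busemann_functions \<omega>.
        filterlim (\<lambda>(m, n). product_wrt b (x m) (x n)) at_top (sequentially \<times>\<^sub>F sequentially))"

definition relative_boundary_equiv ::
  "(nat \<Rightarrow> 'a::metric_space) set \<Rightarrow> ((nat \<Rightarrow> 'a) \<times> (nat \<Rightarrow> 'a)) set" where
  "relative_boundary_equiv \<omega> =
     {(x, y). converges_to_infinity_wrt \<omega> x \<and> converges_to_infinity_wrt \<omega> y \<and>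
              (\<forall>b\<in>busemann_functions \<omega>.
                 filterlim (\<lambda>n. product_wrt b (x n) (y n)) at_top sequentially)}"

definition relative_boundary ::
  "(nat \<Rightarrow> 'a::metric_space) set \<Rightarrow> (nat \<Rightarrow> 'a) set set" where
  "relative_boundary \<omega> = {x. converges_to_infinity_wrt \<omega> x} // relative_boundary_equiv \<omega>"

definition exp_ereal :: "ereal \<Rightarrow> ereal" where
  "exp_ereal a = (case a of ereal r \<Rightarrow> ereal (exp r) | PInfty \<Rightarrow> \<infinity> | MInfty \<Rightarrow> 0)"

definition visual_metric ::
  "(nat \<Rightarrow> 'a::metric_space) set \<Rightarrow> real \<Rightarrow>
   ((nat \<Rightarrow> 'a) set \<Rightarrow> (nat \<Rightarrow> 'a) set \<Rightarrow> real) \<Rightarrow> bool" where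
  "visual_metric \<omega> \<epsilon> d \<longleftrightarrow>
     Metric_space (relative_boundary \<omega>) d \<and> \<epsilon> > 0 \<and>
     (\<exists>b\<in>busemann_functions \<omega>. \<exists>C\<ge>1. \<forall>\<zeta>\<in>relative_boundary \<omega>. \<forall>\<xi>\<in>relative_boundary \<omega>.
        ereal (inverse C) * exp_ereal (- (ereal \<epsilon> * boundary_product_wrt b \<zeta> \<xi>)) \<le> ereal (d \<zeta> \<xi>) \<and>
        ereal (d \<zeta> \<xi>) \<le> ereal C * exp_ereal (- (ereal \<epsilon> * boundary_product_wrt b \<zeta> \<xi>)))"

section \<open>The infinite hyperbolic cone and rough similarity\<close>

text \<open>The cone over \<open>(Z, d)\<close> is the metric space with carrier \<open>hyperbolic_cone Z\<close> and metric \<open>hyperbolic_cone_dist d\<close>.\<close>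

definition hyperbolic_cone :: "'z set \<Rightarrow> ('z \<times> real) set" where
  "hyperbolic_cone Z = Z \<times> {0<..}"

definition hyperbolic_cone_dist :: "('z \<Rightarrow> 'z \<Rightarrow> real) \<Rightarrow> 'z \<times> real \<Rightarrow> 'z \<times> real \<Rightarrow> real" where
  "hyperbolic_cone_dist d = (\<lambda>(x, s) (y, t). 2 * ln ((d x y + max s t) / sqrt (s * t)))"

definition roughly_similar ::
  "'x set \<Rightarrow> ('x \<Rightarrow> 'x \<Rightarrow> real) \<Rightarrow> 'y set \<Rightarrow> ('y \<Rightarrow> 'y \<Rightarrow> real) \<Rightarrow> bool" where
  "roughly_similar X dX Y dY \<longleftrightarrow>
     (\<exists>\<alpha>>0. \<exists>k\<ge>0. \<exists>g\<in>X \<rightarrow> Y.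
        (\<forall>y\<in>Y. \<exists>x\<in>X. dY y (g x) \<le> k) \<and>
        (\<forall>x\<in>X. \<forall>z\<in>X. \<alpha> * dX x z - k \<le> dY (g x) (g z) \<and> dY (g x) (g z) \<le> \<alpha> * dX x z + k))"

end

theory Submission
  imports Defs
begin

text \<open>
  Let $b$ be the Busemann function of the visual metric. Each point $x$ is uniformly close to a
  line from $\omega$ to some boundary point $\zeta_x \neq \omega$, that is
  $(x|\zeta_x)_b \ge b(x) - K$, and the rough similarity is
  $x \mapsto (\zeta_x, e^{-\varepsilon b(x)})$ with factor $\varepsilon$. Hyperbolicity of
  $(\cdot|\cdot)_b$ yields $(x|y)_b = \min\{(\zeta_x|\zeta_y)_b, b(x), b(y)\}$ up to a constant.
  Hence $d(\zeta_x,\zeta_y) + \max\{e^{-\varepsilon b(x)}, e^{-\varepsilon b(y)}\}$ is comparable to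
  $e^{-\varepsilon (x|y)_b}$, and the cone distance equals
  $\varepsilon(b(x) + b(y) - 2(x|y)_b) = \varepsilon d_X(x,y)$ up to a constant. Coarse surjectivity
  holds because the line from $\omega$ to any $\zeta$ passes through every height $h$.
\<close>

section \<open>Busemann functions along a sequence\<close>

lemma gromov_product_nonneg: "0 \<le> gromov_product p x y"
  using dist_triangle[of x y p] by (simp add: gromov_product_def dist_commute)

lemma gromov_product_le_dist: "gromov_product p x y \<le> dist y p"
  using dist_triangle[of x p y] by (simp add: gromov_product_def dist_commute)

lemma gromov_product_commute: "gromov_product p x y = gromov_product p y x"
  by (simp add: gromov_product_def dist_commute)

lemma filterlim_prod_sequentially_at_top:
  "filterlim (\<lambda>(m, n). f m n) at_top (sequentially \<times>\<^sub>F sequentially) \<longleftrightarrow>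
     (\<forall>L::real. \<exists>N. \<forall>m\<ge>N. \<forall>n\<ge>N. L \<le> f m n)"
  unfolding filterlim_at_top eventually_prod_sequentially by fastforce

text \<open>Late terms of one representative compute the infimum over all of them: products with
  \<open>y\<close> never exceed \<open>dist y q\<close>, so once the product of two points is larger
  than that, the minimum in hyperbolicity is the product with \<open>y\<close>, and exchanging the
  two points costs only \<delta>.\<close>

lemma boundary_product_approx:
  fixes q y :: "'a::metric_space"
  assumes hyp: "\<And>x y z p :: 'a.
      gromov_product p x y \<ge> min (gromov_product p x z) (gromov_product p z y) - \<delta>"
    and \<omega>: "\<omega> = boundary_equiv `` {w}" and w: "converges_to_infinity w"
  shows "\<forall>\<^sub>F i in sequentially.
      \<bar>gromov_product q (w i) y - real_of_ereal (boundary_product q \<omega> y)\<bar> \<le> 3 * \<delta>"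
proof -
  have near: "\<bar>gromov_product q u y - gromov_product q v y\<bar> \<le> \<delta>"
    if "dist y q + 1 \<le> gromov_product q u v" for u v
    using hyp[where p = q and x = u and z = v and y = y] hyp[where p = q and x = v and z = u and y = y] that
      gromov_product_le_dist[of q u y] gromov_product_le_dist[of q v y]
    by (auto simp: gromov_product_commute[of q v u] min_def split: if_splits)
  obtain N where N: "\<And>i j. i \<ge> N \<Longrightarrow> j \<ge> N \<Longrightarrow> dist y q + 1 \<le> gromov_product q (w i) (w j)"
    using w unfolding converges_to_infinity_def filterlim_prod_sequentially_at_top by meson
  \<comment> \<open>One \<delta> pays for passing from \<open>w N\<close> to \<open>w i\<close>, the
    other for passing from \<open>w i\<close> to \<open>v i\<close>.\<close>
  have lower: "ereal (gromov_product q (w N) y - 2 * \<delta>) \<le> boundary_product q \<omega> y"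
    unfolding boundary_product_def
  proof (intro INF_greatest Liminf_bounded)
    fix v assume "v \<in> \<omega>"
    then have "filterlim (\<lambda>i. gromov_product q (w i) (v i)) at_top sequentially"
      by (auto simp: \<omega> boundary_equiv_def)
    then have "\<forall>\<^sub>F i in sequentially. dist y q + 1 \<le> gromov_product q (w i) (v i)"
      unfolding filterlim_at_top by blast
    then show "\<forall>\<^sub>F i in sequentially.
        ereal (gromov_product q (w N) y - 2 * \<delta>) \<le> ereal (gromov_product q (v i) y)"
      using eventually_ge_at_top[of N]
    proof eventually_elim
      case (elim i)
      then show ?case using near[of "w i" "v i"] near[OF N[of N i]] by simp
    qed
  qed
  have "filterlim (\<lambda>i. gromov_product p (w i) (w i)) at_top sequentially" for p
    using w unfolding converges_to_infinity_def filterlim_prod_sequentially_at_top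
    unfolding filterlim_at_top eventually_sequentially by meson
  then have w_in: "w \<in> \<omega>"
    using w unfolding \<omega> boundary_equiv_def by blast
  have upper: "boundary_product q \<omega> y \<le> ereal (gromov_product q (w N) y + \<delta>)"
    unfolding boundary_product_def
  proof (rule INF_lower2[OF w_in])
    have "\<forall>\<^sub>F i in sequentially.
        ereal (gromov_product q (w i) y) \<le> ereal (gromov_product q (w N) y + \<delta>)"
      using eventually_ge_at_top[of N]
    proof eventually_elim
      case (elim i)
      then show ?case using near[OF N[of N i]] by simp
    qed
    then have "liminf (\<lambda>i. ereal (gromov_product q (w i) y))
        \<le> liminf (\<lambda>i. ereal (gromov_product q (w N) y + \<delta>))"
      by (rule Liminf_mono)
    then show "liminf (\<lambda>i. ereal (gromov_product q (w i) y)) \<le> ereal (gromov_product q (w N) y + \<delta>)"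
      by (simp add: Liminf_const)
  qed
  obtain r where r: "boundary_product q \<omega> y = ereal r"
    using lower upper by (cases "boundary_product q \<omega> y") auto
  show ?thesis
    using eventually_ge_at_top[of N]
  proof eventually_elim
    case (elim i)
    then show ?case using near[OF N[of N i]] lower upper r by (simp add: abs_le_iff)
  qed
qed

text \<open>Both boundary products in \<open>busemann\<close> are within 3\<delta> of products with
  \<open>w i\<close>, whose difference telescopes to a difference of distances to
  \<open>w i\<close>. Since \<open>c\<close> does not depend on \<open>x\<close>, inequalities for
  \<open>b\<close> at finitely many points can be checked at a single late
  \<open>w i\<close>.\<close>

lemma busemann_function_approx:
  fixes \<omega> :: "(nat \<Rightarrow> 'a::metric_space) set"
  assumes hyp: "\<And>x y z p :: 'a.
      gromov_product p x y \<ge> min (gromov_product p x z) (gromov_product p z y) - \<delta>"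
    and \<omega>: "\<omega> = boundary_equiv `` {w}" and w: "converges_to_infinity w"
    and b: "b \<in> busemann_functions \<omega>"
  obtains c where "c \<ge> 0"
    "\<And>x. \<forall>\<^sub>F i in sequentially. \<bar>b x - (dist x (w i) - dist p (w i))\<bar> \<le> c"
proof -
  obtain q c where c: "\<And>x. \<bar>b x - busemann \<omega> q x\<bar> \<le> c"
    using b unfolding busemann_functions_def by blast
  have "\<forall>\<^sub>F i in sequentially.
      \<bar>b x - (dist x (w i) - dist p (w i))\<bar> \<le> \<bar>c\<bar> + 6 * \<bar>\<delta>\<bar> + dist p q" for x
    using boundary_product_approx[OF hyp \<omega> w, of x q] boundary_product_approx[OF hyp \<omega> w, of q x]
  proof eventually_elim
    case (elim i)
    have "gromov_product x (w i) q - gromov_product q (w i) x = dist x (w i) - dist q (w i)"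
      by (simp add: gromov_product_def dist_commute field_simps)
    moreover have "\<bar>dist q (w i) - dist p (w i)\<bar> \<le> dist p q"
      using abs_dist_diff_le[of q "w i" p] by (simp add: dist_commute)
    ultimately show ?case
      using elim c[of x] by (simp add: busemann_def)
  qed
  then show ?thesis by (rule that[rotated]) simp
qed

lemma busemann_functions_diff_bounded:
  fixes \<omega> :: "(nat \<Rightarrow> 'a::metric_space) set"
  assumes hyp: "\<And>x y z p :: 'a.
      gromov_product p x y \<ge> min (gromov_product p x z) (gromov_product p z y) - \<delta>"
    and \<omega>: "\<omega> = boundary_equiv `` {w}" and w: "converges_to_infinity w"
    and b: "b \<in> busemann_functions \<omega>" and b': "b' \<in> busemann_functions \<omega>"
  obtains c where "\<And>x. \<bar>b x - b' x\<bar> \<le> c"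
proof -
  \<comment> \<open>The arbitrary base point \<open>undefined\<close> is the same in both estimates
    and cancels.\<close>
  obtain c where c: "\<And>x. \<forall>\<^sub>F i in sequentially. \<bar>b x - (dist x (w i) - dist undefined (w i))\<bar> \<le> c"
    using busemann_function_approx[OF hyp \<omega> w b] by blast
  obtain c' where c': "\<And>x. \<forall>\<^sub>F i in sequentially. \<bar>b' x - (dist x (w i) - dist undefined (w i))\<bar> \<le> c'"
    using busemann_function_approx[OF hyp \<omega> w b'] by blast
  have "\<bar>b x - b' x\<bar> \<le> c + c'" for x
  proof -
    have "\<forall>\<^sub>F i in sequentially. \<bar>b x - b' x\<bar> \<le> c + c'"
      using c[of x] c'[of x] by eventually_elim linarith
    then show ?thesis by simp
  qed
  then show ?thesis by (rule that)
qed

text \<open>Two Busemann functions differ by a bounded amount, which shifts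
  \<open>product_wrt\<close> boundedly, so a single one decides convergence.\<close>

lemma converges_to_infinity_wrt_iff:
  fixes \<omega> :: "(nat \<Rightarrow> 'a::metric_space) set"
  assumes hyp: "\<And>x y z p :: 'a.
      gromov_product p x y \<ge> min (gromov_product p x z) (gromov_product p z y) - \<delta>"
    and \<omega>: "\<omega> = boundary_equiv `` {w}" and w: "converges_to_infinity w"
    and b: "b \<in> busemann_functions \<omega>"
  shows "converges_to_infinity_wrt \<omega> z \<longleftrightarrow>
    (\<forall>L. \<exists>N. \<forall>m\<ge>N. \<forall>n\<ge>N. L \<le> product_wrt b (z m) (z n))"
    (is "_ \<longleftrightarrow> ?conv b")
proof -
  have "?conv b'" if b': "b' \<in> busemann_functions \<omega>" and conv: "?conv b" for b'
  proof
    fix L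
    obtain c where c: "\<And>x. \<bar>b x - b' x\<bar> \<le> c"
      using busemann_functions_diff_bounded[OF hyp \<omega> w b b'] by blast
    have "L \<le> product_wrt b' x y" if "L + c \<le> product_wrt b x y" for x y
      using that c[of x] c[of y] unfolding product_wrt_def by (simp add: abs_le_iff)
    then show "\<exists>N. \<forall>m\<ge>N. \<forall>n\<ge>N. L \<le> product_wrt b' (z m) (z n)"
      using conv by meson
  qed
  then show ?thesis
    using b unfolding converges_to_infinity_wrt_def filterlim_prod_sequentially_at_top by blast
qed

lemma relative_boundary_equiv_self:
  assumes "converges_to_infinity_wrt \<omega> z"
  shows "z \<in> relative_boundary_equiv \<omega> `` {z}"
proof -
  have "filterlim (\<lambda>n. product_wrt b (z n) (z n)) at_top sequentially" if "b \<in> busemann_functions \<omega>" for b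
    using assms that unfolding converges_to_infinity_wrt_def filterlim_prod_sequentially_at_top
    unfolding filterlim_at_top eventually_sequentially by meson
  then show ?thesis
    using assms unfolding relative_boundary_equiv_def by blast
qed

section \<open>Lines ending at the distinguished boundary point\<close>

text \<open>If $b$ is a Busemann function based at $\omega$, normalised at $p$, this is the product
  $(x|\omega)_p$ up to a bounded error.\<close>

definition horo_product :: "'a::metric_space \<Rightarrow> ('a \<Rightarrow> real) \<Rightarrow> 'a \<Rightarrow> real" where
  "horo_product p b x = (dist x p - b x) / 2"

text \<open>The coarse properties of a Busemann function, with one constant for all.
  \<open>hp_hyp\<close> and \<open>hp_hyp'\<close> are hyperbolicity at \<open>p\<close> with
  \<omega> as one of the three points, \<open>product_hyp\<close> is hyperbolicity seen from
  \<omega>, and \<open>hp_unbounded\<close> says that \<omega> can be approached.\<close>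

locale rough_horofunction =
  fixes p :: "'a::metric_space" and b :: "'a \<Rightarrow> real" and \<kappa> :: real
  assumes \<kappa>_nonneg: "\<kappa> \<ge> 0"
    and ray: "\<And>x. \<exists>\<gamma>. roughly_geodesic_ray \<kappa> p \<gamma> \<and> x \<in> \<gamma> ` {0..}"
    and hp_hyp: "\<And>x y. horo_product p b x \<ge> min (gromov_product p x y) (horo_product p b y) - \<kappa>"
    and hp_hyp': "\<And>x y. gromov_product p x y \<ge> min (horo_product p b x) (horo_product p b y) - \<kappa>"
    and product_hyp: "\<And>x y z. product_wrt b x y \<ge> min (product_wrt b x z) (product_wrt b z y) - \<kappa>"
    and base: "\<bar>b p\<bar> \<le> \<kappa>"
    and lipschitz: "\<And>x y. \<bar>b x - b y\<bar> \<le> dist x y + \<kappa>"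
    and hp_unbounded: "\<And>L. \<exists>w. horo_product p b w \<ge> L"
begin

abbreviation hp :: "'a \<Rightarrow> real" where
  "hp \<equiv> horo_product p b"

definition conv :: "(nat \<Rightarrow> 'a) \<Rightarrow> bool" where
  "conv z \<longleftrightarrow> (\<forall>L. \<exists>N. \<forall>m\<ge>N. \<forall>n\<ge>N. L \<le> product_wrt b (z m) (z n))"

text \<open>Since \<open>product_wrt b x (z i)\<close> never exceeds \<open>b x\<close> by more than a constant, this says that
  $x$ is uniformly close to a line from $\omega$ to the limit of $z$.\<close>

definition adapted :: "real \<Rightarrow> 'a \<Rightarrow> (nat \<Rightarrow> 'a) \<Rightarrow> bool" where
  "adapted K x z \<longleftrightarrow> conv z \<and> (\<forall>\<^sub>F i in sequentially. b x - K \<le> product_wrt b x (z i))"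

lemma hp_ge: "- \<kappa> \<le> hp x"
  using lipschitz[of x p] base unfolding horo_product_def by (simp add: abs_if split: if_splits)

lemma hp_le: "hp x \<le> dist x p + \<kappa>"
  using lipschitz[of x p] base unfolding horo_product_def by (simp add: abs_if split: if_splits)

lemma b_eq: "b x = dist x p - 2 * hp x"
  unfolding horo_product_def by (simp add: field_simps)

lemma product_diag: "product_wrt b x x = b x"
  by (simp add: product_wrt_def)

lemma product_le: "product_wrt b x y \<le> b x + \<kappa>" "product_wrt b x y \<le> b y + \<kappa>"
  using lipschitz[of x y] \<kappa>_nonneg unfolding product_wrt_def by (simp_all add: abs_if split: if_splits)

text \<open>An exact change of viewpoint from \<omega> to \<open>p\<close>; through it, estimates on
  rays from \<open>p\<close> become estimates for \<open>product_wrt b\<close>.\<close>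

lemma product_eq: "product_wrt b x y = gromov_product p x y - hp x - hp y"
  by (simp add: product_wrt_def gromov_product_def horo_product_def field_simps)

lemma product_commute: "product_wrt b x y = product_wrt b y x"
  by (simp add: product_wrt_def dist_commute)

section \<open>Rough rays from the base point and sequences converging with respect to
  \<omega>\<close>

lemma ray_dist:
  assumes "roughly_geodesic_ray \<kappa> p \<gamma>" "0 \<le> s" "0 \<le> t"
  shows "\<bar>dist (\<gamma> s) (\<gamma> t) - \<bar>s - t\<bar>\<bar> \<le> \<kappa>"
proof -
  have "\<bar>s - t\<bar> - \<kappa> \<le> dist (\<gamma> s) (\<gamma> t) \<and> dist (\<gamma> s) (\<gamma> t) \<le> \<bar>s - t\<bar> + \<kappa>"
    using assms unfolding roughly_geodesic_ray_def by blast
  then show ?thesis by linarith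
qed

lemma ray_dist_base:
  assumes "roughly_geodesic_ray \<kappa> p \<gamma>" "0 \<le> s"
  shows "\<bar>dist (\<gamma> s) p - s\<bar> \<le> \<kappa>"
  using ray_dist[OF assms order_refl] assms unfolding roughly_geodesic_ray_def by simp

lemma ray_product:
  assumes "roughly_geodesic_ray \<kappa> p \<gamma>" "0 \<le> s" "s \<le> t"
  shows "s - 2 * \<kappa> \<le> gromov_product p (\<gamma> s) (\<gamma> t)"
  using ray_dist[OF assms(1,2), of t] ray_dist_base[OF assms(1), of s] ray_dist_base[OF assms(1), of t] assms \<kappa>_nonneg
  by (simp add: gromov_product_def abs_le_iff)

text \<open>Such a sequence stays away from \<omega>: by \<open>product_eq\<close>, a nonnegative
  product with a fixed term \<open>z N\<close> bounds \<open>hp (z i)\<close> by the product of the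
  two terms at \<open>p\<close>, hence in terms of \<open>dist (z N) p\<close>.\<close>

lemma conv_hp_bounded:
  assumes "conv z"
  obtains D where "D \<ge> 0" "\<forall>\<^sub>F i in sequentially. hp (z i) \<le> D"
proof -
  obtain N where N: "\<And>m n. m \<ge> N \<Longrightarrow> n \<ge> N \<Longrightarrow> 0 \<le> product_wrt b (z m) (z n)"
    using assms unfolding conv_def by meson
  have "hp (z i) \<le> dist (z N) p + \<kappa>" if "i \<ge> N" for i
    using N[OF that order_refl] hp_ge[of "z N"] gromov_product_le_dist[of p "z i" "z N"]
    unfolding product_eq by simp
  then show ?thesis
    by (intro that[of "dist (z N) p + \<kappa>"]) (auto simp: eventually_sequentially \<kappa>_nonneg)
qed

lemma conv_ray:
  assumes \<gamma>: "roughly_geodesic_ray \<kappa> p \<gamma>" and s: "s \<ge> 0"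
    and hp: "\<And>n::nat. s \<le> real n \<Longrightarrow> hp (\<gamma> n) \<le> s"
  shows "conv (\<lambda>n. \<gamma> (real n))"
  unfolding conv_def
proof
  fix L
  \<comment> \<open>2\<kappa> is the loss in \<open>ray_product\<close>, two of the three
    \<open>s\<close> absorb the \<open>hp\<close> terms of \<open>product_eq\<close>, and the third
    ensures \<open>s \<le> real n\<close>, so that the bound on \<open>hp\<close> applies.\<close>
  define N where "N = nat \<lceil>\<bar>L\<bar> + 2 * \<kappa> + 3 * s\<rceil>"
  have N: "\<bar>L\<bar> + 2 * \<kappa> + 3 * s \<le> real n" if "n \<ge> N" for n
    using that unfolding N_def by linarith
  have "L \<le> product_wrt b (\<gamma> m) (\<gamma> n)" if mn: "N \<le> m" "m \<le> n" for m n :: nat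
    using ray_product[OF \<gamma>, of m n] N[of m] N[of n] hp[of m] hp[of n] mn \<kappa>_nonneg s
    unfolding product_eq by linarith
  then show "\<exists>N. \<forall>m\<ge>N. \<forall>n\<ge>N. L \<le> product_wrt b (\<gamma> (real m)) (\<gamma> (real n))"
    by (metis nle_le product_commute)
qed

text \<open>The sequence \<open>z0\<close> is a common fallback for all points near a ray to
  \<omega>; it enters the constant only through the bound \<open>D\<close>, which makes
  \<open>K\<close> independent of \<open>x\<close>.\<close>

lemma exists_adapted_sequence:
  assumes "conv z0"
  obtains K where "K \<ge> 0" "\<And>x. \<exists>z. adapted K x z"
proof -
  obtain D where D: "D \<ge> 0" "\<forall>\<^sub>F i in sequentially. hp (z0 i) \<le> D"
    using conv_hp_bounded[OF assms] .
  have "\<exists>z. adapted (D + 10 * \<kappa>) x z" for x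
  proof -
    obtain \<gamma> s where \<gamma>: "roughly_geodesic_ray \<kappa> p \<gamma>" and s: "s \<ge> 0" and x: "x = \<gamma> s"
      using ray[of x] by auto
    have dx: "\<bar>dist x p - s\<bar> \<le> \<kappa>"
      using ray_dist_base[OF \<gamma> s] x by simp
    show ?thesis
      \<comment> \<open>Either the ray through $x$ leaves the direction of $\omega$ before $x$, and then $x$ is on
        the line to its endpoint; or $x$ is near a ray from $p$ to $\omega$, which up to a constant is
        part of the line to the limit of \<open>z0\<close>.\<close>
    proof (cases "\<forall>n::nat. s \<le> real n \<longrightarrow> hp (\<gamma> n) \<le> s")
      case True
      have "b x - (D + 10 * \<kappa>) \<le> product_wrt b x (\<gamma> (real n))" if n: "s \<le> real n" for n :: nat
      proof -
        have 1: "s - 2 * \<kappa> \<le> gromov_product p x (\<gamma> n)"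
          unfolding x by (rule ray_product[OF \<gamma> s n])
        \<comment> \<open>Both terms of the minimum in \<open>hp_hyp\<close> are at least
          \<open>hp (\<gamma> n) - 2 * \<kappa>\<close>, because
          \<open>hp (\<gamma> n) \<le> s\<close> in this case.\<close>
        then have "hp (\<gamma> n) \<le> hp x + 3 * \<kappa>"
          using hp_hyp[of x "\<gamma> n"] True n \<kappa>_nonneg by (auto simp: min_def split: if_splits)
        then show ?thesis
          unfolding product_eq b_eq[of x] using 1 dx \<kappa>_nonneg D(1) by linarith
      qed
      then have "\<forall>\<^sub>F n in sequentially. b x - (D + 10 * \<kappa>) \<le> product_wrt b x (\<gamma> (real n))"
        unfolding eventually_sequentially by (metis of_nat_le_iff order_trans real_arch_simple)
      then show ?thesis
        using conv_ray[OF \<gamma> s] True unfolding adapted_def by blast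
    next
      case False
      then obtain n :: nat where n: "s \<le> real n" "s < hp (\<gamma> n)" by auto
      have "s - 2 * \<kappa> \<le> gromov_product p x (\<gamma> n)"
        unfolding x by (rule ray_product[OF \<gamma> s n(1)])
      \<comment> \<open>Thus \<open>hp x\<close> is at least \<open>dist x p - 4 * \<kappa>\<close>,
        and nonnegativity of the product of \<open>x\<close> and \<open>z0 i\<close> at
        \<open>p\<close> is enough below.\<close>
      then have hpx: "s - 3 * \<kappa> \<le> hp x"
        using hp_hyp[of x "\<gamma> n"] n \<kappa>_nonneg by (auto simp: min_def split: if_splits)
      have "\<forall>\<^sub>F i in sequentially. b x - (D + 10 * \<kappa>) \<le> product_wrt b x (z0 i)"
        using D(2)
      proof eventually_elim
        case (elim i)
        then show ?case
          unfolding product_eq b_eq[of x]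
          using gromov_product_nonneg[of p x "z0 i"] dx hpx \<kappa>_nonneg by linarith
      qed
      then show ?thesis
        using assms unfolding adapted_def by blast
    qed
  qed
  then show ?thesis
    using D(1) \<kappa>_nonneg by (intro that[of "D + 10 * \<kappa>"]) auto
qed

text \<open>The points $p$, $\omega$, $z$ span a tripod whose branching point has height
  \<open>- hp z\<close>: above it $u$ lies on the leg to $z$, below it on the leg to $\omega$.\<close>

lemma exists_on_line:
  assumes h: "h \<le> b z"
  obtains u where "\<bar>b u - h\<bar> \<le> 20 * \<kappa>" "b u - 20 * \<kappa> \<le> product_wrt b u z"
proof (cases "- hp z \<le> h")
  case True
  \<comment> \<open>On the leg to \<open>z\<close> one expects \<open>hp u\<close> to be about
    \<open>hp z\<close>, so solving \<open>b u = h\<close> in \<open>b_eq\<close> gives this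
    distance from \<open>p\<close>. Truncation at 0 costs at most \<kappa>, as \<open>hp z\<close>
    may be slightly negative; \<open>h \<le> b z\<close> keeps \<open>r\<close> from passing
    \<open>z\<close> by more than 2\<kappa>.\<close>
  define r where "r = max 0 (h + 2 * hp z)"
  obtain \<gamma> t where \<gamma>: "roughly_geodesic_ray \<kappa> p \<gamma>" and t: "t \<ge> 0" and z: "z = \<gamma> t"
    using ray[of z] by auto
  have r: "0 \<le> r" "\<bar>r - (h + 2 * hp z)\<bar> \<le> \<kappa>" "hp z \<le> r" "r \<le> t + 2 * \<kappa>"
    using True hp_ge[of z] h t ray_dist_base[OF \<gamma> t] z \<kappa>_nonneg b_eq[of z] unfolding r_def by auto
  define u where "u = \<gamma> r"
  have du: "\<bar>dist u p - r\<bar> \<le> \<kappa>" "\<bar>dist z p - t\<bar> \<le> \<kappa>" "dist u z \<le> \<bar>r - t\<bar> + \<kappa>"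
    using ray_dist[OF \<gamma> r(1) t] ray_dist_base[OF \<gamma> r(1)] ray_dist_base[OF \<gamma> t] unfolding u_def z by auto
  have uz: "r - 4 * \<kappa> \<le> gromov_product p u z"
  proof -
    have "\<bar>r - t\<bar> \<le> t - r + 4 * \<kappa>" using r(4) \<kappa>_nonneg by (simp add: abs_if)
    then have "dist u z \<le> t - r + 5 * \<kappa>" using du(3) by linarith
    then show ?thesis using du(1,2) \<kappa>_nonneg unfolding gromov_product_def by (simp add: abs_le_iff)
  qed
  \<comment> \<open>Since \<open>u\<close> and \<open>z\<close> share a ray up to \<open>r\<close>,
    which is at least \<open>hp z\<close>, both branch off from the direction of \<omega> together;
    \<open>hp_hyp\<close> in both directions gives the two bounds.\<close>
  have lo: "hp z - 5 * \<kappa> \<le> hp u"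
    using hp_hyp[of u z] uz r(3) \<kappa>_nonneg by (auto simp: min_def split: if_splits)
  have "min r (hp u) - 5 * \<kappa> \<le> hp z"
    using hp_hyp[of z u] uz \<kappa>_nonneg unfolding gromov_product_commute[of p z u]
    by (auto simp: min_def split: if_splits)
  then have hi: "hp u \<le> hp z + 7 * \<kappa>"
    using hp_le[of u] du(1) r(3) by (auto simp: min_def split: if_splits)
  show ?thesis
  proof (rule that)
    show "\<bar>b u - h\<bar> \<le> 20 * \<kappa>"
      unfolding b_eq[of u] using lo hi du(1) r(2) by linarith
    show "b u - 20 * \<kappa> \<le> product_wrt b u z"
      unfolding b_eq[of u] product_eq using uz du(1) lo hi \<kappa>_nonneg by linarith
  qed
next
  case False
  \<comment> \<open>On the leg to \<omega>, \<open>hp u\<close> is about \<open>dist u p\<close>, so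
    \<open>b u\<close> is about \<open>- dist u p\<close>.\<close>
  define r where "r = max 0 (- h)"
  have r: "0 \<le> r" "\<bar>r + h\<bar> \<le> \<kappa>" "hp z \<le> r"
    using False hp_ge[of z] \<kappa>_nonneg unfolding r_def by auto
  \<comment> \<open>A ray from \<open>p\<close> to a point this close to \<omega> follows the
    direction of \<omega> up to distance \<open>r\<close>; the margin 2\<kappa> yields
    \<open>r \<le> t\<close>.\<close>
  obtain w where w: "r + 2 * \<kappa> \<le> hp w" using hp_unbounded by blast
  obtain \<gamma> t where \<gamma>: "roughly_geodesic_ray \<kappa> p \<gamma>" and t: "t \<ge> 0" and wt: "w = \<gamma> t"
    using ray[of w] by auto
  have "\<bar>dist w p - t\<bar> \<le> \<kappa>" unfolding wt using ray_dist_base[OF \<gamma> t] .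
  then have "r \<le> t" using hp_le[of w] w by linarith
  define u where "u = \<gamma> r"
  have uw: "r - 2 * \<kappa> \<le> gromov_product p u w"
    unfolding u_def wt by (rule ray_product[OF \<gamma> r(1) \<open>r \<le> t\<close>])
  have du: "\<bar>dist u p - r\<bar> \<le> \<kappa>"
    unfolding u_def using ray_dist_base[OF \<gamma> r(1)] .
  have lo: "r - 3 * \<kappa> \<le> hp u"
    using hp_hyp[of u w] uw w \<kappa>_nonneg by (auto simp: min_def split: if_splits)
  have hi: "hp u \<le> r + 2 * \<kappa>"
    using hp_le[of u] du by linarith
  have uz: "hp z - 4 * \<kappa> \<le> gromov_product p u z"
    using hp_hyp'[of u z] lo r(3) \<kappa>_nonneg by (auto simp: min_def split: if_splits)
  show ?thesis
  proof (rule that)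
    show "\<bar>b u - h\<bar> \<le> 20 * \<kappa>"
      unfolding b_eq[of u] using lo hi du r(2) \<kappa>_nonneg by linarith
    show "b u - 20 * \<kappa> \<le> product_wrt b u z"
      unfolding b_eq[of u] product_eq using uz du lo hi \<kappa>_nonneg by linarith
  qed
qed

text \<open>A point on the line to one late term \<open>z N\<close> serves for the whole tail by
  \<open>product_hyp\<close>: products of \<open>z N\<close> with later terms are at least
  \<open>h + 20 * \<kappa>\<close>, hence at least \<open>b u\<close>.\<close>

lemma exists_adapted_point:
  assumes "conv z"
  obtains u where "\<bar>b u - h\<bar> \<le> 20 * \<kappa>" "adapted (30 * \<kappa>) u z"
proof -
  obtain N where N: "\<And>m n. m \<ge> N \<Longrightarrow> n \<ge> N \<Longrightarrow> h + 20 * \<kappa> \<le> product_wrt b (z m) (z n)"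
    using assms unfolding conv_def by meson
  have "h \<le> b (z N)"
    using N[of N N] \<kappa>_nonneg by (simp add: product_diag)
  from exists_on_line[OF this] obtain u where u: "\<bar>b u - h\<bar> \<le> 20 * \<kappa>" "b u - 20 * \<kappa> \<le> product_wrt b u (z N)" .
  have "b u - 30 * \<kappa> \<le> product_wrt b u (z n)" if "n \<ge> N" for n
    using product_hyp[of u "z N" "z n"] N[of N n] u that \<kappa>_nonneg by (auto simp: min_def split: if_splits)
  then have "adapted (30 * \<kappa>) u z"
    using assms unfolding adapted_def eventually_sequentially by blast
  then show ?thesis using u(1) that by blast
qed

section \<open>Products of points against products along adapted sequences\<close>

lemma product_ge_of_adapted:
  assumes "adapted K x z" "adapted K y z'" "K \<ge> 0"
    and "\<forall>\<^sub>F i in sequentially. r \<le> product_wrt b (z i) (z' i)"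
  shows "min r (min (b x) (b y)) - K - 2 * \<kappa> \<le> product_wrt b x y"
proof -
  have "\<forall>\<^sub>F i in sequentially. b x - K \<le> product_wrt b x (z i)"
    "\<forall>\<^sub>F i in sequentially. b y - K \<le> product_wrt b y (z' i)"
    using assms(1,2) unfolding adapted_def by auto
  then have "\<forall>\<^sub>F i in sequentially. min r (min (b x) (b y)) - K - 2 * \<kappa> \<le> product_wrt b x y"
    using assms(4)
  proof eventually_elim
    \<comment> \<open>Hyperbolicity along the chain \<open>x\<close>, \<open>z i\<close>,
      \<open>z' i\<close>, \<open>y\<close> uses two steps, hence 2\<kappa>.\<close>
    case (elim i)
    then show ?case
      using product_hyp[of x "z i" y] product_hyp[of "z i" "z' i" y] assms(3) \<kappa>_nonneg
      unfolding product_commute[of "z' i" y] by (auto simp: min_def split: if_splits)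
  qed
  then show ?thesis by simp
qed

text \<open>Hyperbolicity along the chain \<open>u i\<close>, \<open>z i\<close>, \<open>x\<close>,
  \<open>y\<close>, \<open>z' i\<close>, \<open>v i\<close>. Every link is at least
  \<open>product_wrt b x y - K - \<kappa>\<close>: the inner ones by \<open>adapted\<close> and
  \<open>product_le\<close>, the outer ones because they tend to infinity. Allowing arbitrary
  \<open>u\<close> and \<open>v\<close> handles the infimum over representatives.\<close>

lemma product_le_of_adapted:
  assumes "adapted K x z" "adapted K y z'" "K \<ge> 0"
    and u: "filterlim (\<lambda>i. product_wrt b (z i) (u i)) at_top sequentially"
    and v: "filterlim (\<lambda>i. product_wrt b (z' i) (v i)) at_top sequentially"
  shows "\<forall>\<^sub>F i in sequentially. product_wrt b x y - K - 5 * \<kappa> \<le> product_wrt b (u i) (v i)"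
proof -
  have "\<forall>\<^sub>F i in sequentially. b x - K \<le> product_wrt b x (z i)"
    "\<forall>\<^sub>F i in sequentially. b y - K \<le> product_wrt b y (z' i)"
    using assms(1,2) unfolding adapted_def by auto
  moreover have "\<forall>\<^sub>F i in sequentially. product_wrt b x y \<le> product_wrt b (z i) (u i)"
    "\<forall>\<^sub>F i in sequentially. product_wrt b x y \<le> product_wrt b (z' i) (v i)"
    using u v unfolding filterlim_at_top by auto
  ultimately show ?thesis
  proof eventually_elim
    case (elim i)
    have "product_wrt b x y - K - 2 * \<kappa> \<le> product_wrt b x (u i)"
      using product_hyp[of x "z i" "u i"] elim product_le(1)[of x y] assms(3) \<kappa>_nonneg
      by (auto simp: min_def split: if_splits)
    moreover have "product_wrt b x y - K - 2 * \<kappa> \<le> product_wrt b y (v i)"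
      using product_hyp[of y "z' i" "v i"] elim product_le(2)[of x y] assms(3) \<kappa>_nonneg
      by (auto simp: min_def split: if_splits)
    ultimately show ?case
      using product_hyp[of "u i" x "v i"] product_hyp[of x y "v i"] assms(3) \<kappa>_nonneg
      unfolding product_commute[of x "u i"] by (auto simp: min_def product_commute split: if_splits)
  qed
qed

end

text \<open>Each hyperbolicity or Lipschitz inequality involves at most three points, so one index
  \<open>i\<close> lets \<open>w i\<close> stand in for \<omega>, and the inequality follows from
  its counterpart for \<open>w i\<close>.\<close>

lemma rough_horofunction_busemann:
  fixes \<omega> :: "(nat \<Rightarrow> 'a::metric_space) set" and p :: 'a
  assumes \<delta>: "\<delta> \<ge> 0" and hyp: "\<And>x y z p :: 'a.
      gromov_product p x y \<ge> min (gromov_product p x z) (gromov_product p z y) - \<delta>"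
    and k: "k \<ge> 0" and ray: "\<And>x. \<exists>\<gamma>. roughly_geodesic_ray k p \<gamma> \<and> x \<in> \<gamma> ` {0..}"
    and \<omega>: "\<omega> = boundary_equiv `` {w}" and w: "converges_to_infinity w"
    and b: "b \<in> busemann_functions \<omega>"
  obtains \<kappa> where "rough_horofunction p b \<kappa>"
proof -
  obtain c where c: "c \<ge> 0"
    "\<And>x. \<forall>\<^sub>F i in sequentially. \<bar>b x - (dist x (w i) - dist p (w i))\<bar> \<le> c"
    using busemann_function_approx[OF hyp \<omega> w b] by blast
  define \<kappa> where "\<kappa> = \<delta> + k + 4 * c"
  have near_w: "\<exists>i. \<bar>b x - (dist x (w i) - dist p (w i))\<bar> \<le> c \<and>
      \<bar>b y - (dist y (w i) - dist p (w i))\<bar> \<le> c \<and> \<bar>b z - (dist z (w i) - dist p (w i))\<bar> \<le> c" for x y z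
  proof (rule eventually_happens'[OF sequentially_bot])
    show "\<forall>\<^sub>F i in sequentially. \<bar>b x - (dist x (w i) - dist p (w i))\<bar> \<le> c \<and>
      \<bar>b y - (dist y (w i) - dist p (w i))\<bar> \<le> c \<and> \<bar>b z - (dist z (w i) - dist p (w i))\<bar> \<le> c"
      using c(2) by (intro eventually_conj)
  qed
  have horo: "\<bar>horo_product p b x - gromov_product p x v\<bar> \<le> c"
    if "\<bar>b x - (dist x v - dist p v)\<bar> \<le> c" for x v
    using that c(1) unfolding horo_product_def gromov_product_def
    by (simp add: dist_commute abs_le_iff field_simps)
  \<comment> \<open>The shift \<open>dist p v\<close> is common to all three products and cancels in
    hyperbolicity at \<open>v\<close>.\<close>
  have prod: "\<bar>product_wrt b x y - (gromov_product v x y - dist p v)\<bar> \<le> c"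
    if "\<bar>b x - (dist x v - dist p v)\<bar> \<le> c" "\<bar>b y - (dist y v - dist p v)\<bar> \<le> c" for x y v
    using that c(1) unfolding product_wrt_def gromov_product_def
    by (simp add: dist_commute abs_le_iff field_simps)
  have "rough_horofunction p b \<kappa>"
  proof
    show "\<kappa> \<ge> 0" using \<delta> k c(1) by (simp add: \<kappa>_def)
    show "\<exists>\<gamma>. roughly_geodesic_ray \<kappa> p \<gamma> \<and> x \<in> \<gamma> ` {0..}" for x
    proof -
      obtain \<gamma> where "roughly_geodesic_ray k p \<gamma>" "x \<in> \<gamma> ` {0..}" using ray by blast
      moreover have "k \<le> \<kappa>" using \<delta> c(1) by (simp add: \<kappa>_def)
      ultimately have "roughly_geodesic_ray \<kappa> p \<gamma>"
        unfolding roughly_geodesic_ray_def by (smt (verit))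
      then show ?thesis using \<open>x \<in> \<gamma> ` {0..}\<close> by blast
    qed
    show "min (gromov_product p x y) (horo_product p b y) - \<kappa> \<le> horo_product p b x"
      and "min (horo_product p b x) (horo_product p b y) - \<kappa> \<le> gromov_product p x y" for x y
    proof -
      obtain i where i: "\<bar>b x - (dist x (w i) - dist p (w i))\<bar> \<le> c"
        "\<bar>b y - (dist y (w i) - dist p (w i))\<bar> \<le> c"
        using near_w[of x y y] by blast
      note * = horo[OF i(1)] horo[OF i(2)] \<delta> k c(1)
      show "min (gromov_product p x y) (horo_product p b y) - \<kappa> \<le> horo_product p b x"
        using hyp[where p = p and x = x and y = "w i" and z = y] * unfolding \<kappa>_def
        by (auto simp: min_def split: if_splits)
      show "min (horo_product p b x) (horo_product p b y) - \<kappa> \<le> gromov_product p x y"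
        using hyp[where p = p and x = x and y = y and z = "w i"] *
        unfolding \<kappa>_def gromov_product_commute[of p "w i" y]
        by (auto simp: min_def split: if_splits)
    qed
    show "min (product_wrt b x z) (product_wrt b z y) - \<kappa> \<le> product_wrt b x y" for x y z
    proof -
      obtain i where i: "\<bar>b x - (dist x (w i) - dist p (w i))\<bar> \<le> c"
        "\<bar>b y - (dist y (w i) - dist p (w i))\<bar> \<le> c" "\<bar>b z - (dist z (w i) - dist p (w i))\<bar> \<le> c"
        using near_w[of x y z] by blast
      show ?thesis
        using hyp[where p = "w i" and x = x and y = y and z = z] prod[OF i(1,2)] prod[OF i(1,3)]
          prod[OF i(3,2)] \<delta> k c(1) unfolding \<kappa>_def
        by (auto simp: min_def split: if_splits)
    qed
    show "\<bar>b p\<bar> \<le> \<kappa>"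
      using near_w[of p p p] \<delta> k c(1) unfolding \<kappa>_def by auto
    show "\<bar>b x - b y\<bar> \<le> dist x y + \<kappa>" for x y
    proof -
      obtain i where i: "\<bar>b x - (dist x (w i) - dist p (w i))\<bar> \<le> c"
        "\<bar>b y - (dist y (w i) - dist p (w i))\<bar> \<le> c"
        using near_w[of x y y] by blast
      then show ?thesis
        using abs_dist_diff_le[of x "w i" y] \<delta> k c(1)
        unfolding \<kappa>_def dist_commute[of "w i" y] by linarith
    qed
    show "\<exists>v. L \<le> horo_product p b v" for L
    proof -
      \<comment> \<open>The witness is \<open>w N\<close>: its \<open>hp\<close> value is within
        \<open>c\<close> of its product with a late \<open>w j\<close>.\<close>
      obtain N where N: "\<And>i j. i \<ge> N \<Longrightarrow> j \<ge> N \<Longrightarrow> L + c \<le> gromov_product p (w i) (w j)"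
        using w unfolding converges_to_infinity_def filterlim_prod_sequentially_at_top by meson
      obtain j where "\<bar>b (w N) - (dist (w N) (w j) - dist p (w j))\<bar> \<le> c" "j \<ge> N"
        using eventually_happens'[OF sequentially_bot
            eventually_conj[OF c(2)[of "w N"] eventually_ge_at_top[of N]]] by blast
      then show ?thesis
        using horo[of "w N" "w j"] N[of N j] by (intro exI[of _ "w N"]) linarith
    qed
  qed
  then show ?thesis by (rule that)
qed

section \<open>Distances in the hyperbolic cone\<close>

text \<open>Here \<open>a\<close> plays the product of two points, \<beta>1 and \<beta>2 their
  heights, \<open>D\<close> the visual distance and \<open>E\<close> its exponential model. The
  numerator is comparable to \<open>exp (- (\<epsilon> * a))\<close>; taking logarithms turns the
  factors into additive errors.\<close>

lemma cone_dist_estimate: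
  fixes C D E K a \<beta>1 \<beta>2 \<epsilon> :: real
  assumes "\<epsilon> > 0" "C \<ge> 1" "K \<ge> 0" "E \<ge> 0"
    and a: "a \<le> \<beta>1 + K" "a \<le> \<beta>2 + K"
    and D: "E \<le> C * D" "D \<le> C * E"
    and E: "E \<le> exp (- (\<epsilon> * (a - K)))"
    and m: "exp (- (\<epsilon> * (a + K))) \<le> max E (max (exp (- (\<epsilon> * \<beta>1))) (exp (- (\<epsilon> * \<beta>2))))"
  shows "\<bar>2 * ln ((D + max (exp (- (\<epsilon> * \<beta>1))) (exp (- (\<epsilon> * \<beta>2)))) /
             sqrt (exp (- (\<epsilon> * \<beta>1)) * exp (- (\<epsilon> * \<beta>2)))) - \<epsilon> * (\<beta>1 + \<beta>2 - 2 * a)\<bar>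
         \<le> 2 * (ln (C + 1) + \<epsilon> * K)"
proof -
  define s t where "s = exp (- (\<epsilon> * \<beta>1))" and "t = exp (- (\<epsilon> * \<beta>2))"
  define S where "S = D + max s t"
  have pos: "s > 0" "t > 0" by (auto simp: s_def t_def)
  have D0: "D \<ge> 0"
  proof (rule ccontr)
    assume "\<not> D \<ge> 0"
    then have "C * D < 0" using assms(2) by (intro mult_pos_neg) auto
    then show False using D(1) \<open>E \<ge> 0\<close> by simp
  qed
  have S0: "S > 0" using D0 pos unfolding S_def by (simp add: max_def)
  have st: "s \<le> exp (- (\<epsilon> * (a - K)))" "t \<le> exp (- (\<epsilon> * (a - K)))"
    using a assms(1) by (simp_all add: s_def t_def)
  \<comment> \<open>The factor \<open>C + 1\<close> consists of \<open>C\<close> from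
    \<open>D \<le> C * E\<close> and 1 from \<open>max s t\<close>.\<close>
  have "S \<le> C * exp (- (\<epsilon> * (a - K))) + exp (- (\<epsilon> * (a - K)))"
  proof -
    have "C * E \<le> C * exp (- (\<epsilon> * (a - K)))"
      using E assms(2) by (intro mult_left_mono) auto
    then show ?thesis using D(2) st unfolding S_def by simp
  qed
  then have "S \<le> (C + 1) * exp (- (\<epsilon> * (a - K)))" by (simp add: algebra_simps)
  then have "ln S \<le> ln ((C + 1) * exp (- (\<epsilon> * (a - K))))" using S0 by simp
  also have "\<dots> = ln (C + 1) - \<epsilon> * (a - K)" using assms(2) by (simp add: ln_mult)
  finally have hi: "ln S \<le> ln (C + 1) - \<epsilon> * (a - K)" .
  have "exp (- (\<epsilon> * (a + K))) \<le> (C + 1) * S"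
  proof -
    have "E \<le> (C + 1) * D" using D(1) D0 by (simp add: algebra_simps)
    moreover have "max s t \<le> (C + 1) * max s t" using pos assms(2) by (simp add: max_def)
    moreover have "0 \<le> (C + 1) * D" "0 \<le> (C + 1) * max s t"
      using D0 pos assms(2) by (simp_all add: max_def)
    ultimately show ?thesis
      using m unfolding S_def distrib_left s_def[symmetric] t_def[symmetric] by linarith
  qed
  then have "- (\<epsilon> * (a + K)) \<le> ln ((C + 1) * S)" using S0 assms(2) by (simp add: ln_ge_iff)
  also have "\<dots> = ln (C + 1) + ln S" using S0 assms(2) by (simp add: ln_mult)
  finally have lo: "- (\<epsilon> * (a + K)) - ln (C + 1) \<le> ln S" by simp
  have "2 * ln (S / sqrt (s * t)) = 2 * ln S - ln (s * t)"
    using S0 pos by (simp add: ln_div ln_sqrt)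
  also have "\<dots> = 2 * ln S + \<epsilon> * (\<beta>1 + \<beta>2)"
    by (simp add: s_def t_def ln_mult algebra_simps)
  finally have "2 * ln (S / sqrt (s * t)) - \<epsilon> * (\<beta>1 + \<beta>2 - 2 * a) = 2 * (ln S + \<epsilon> * a)"
    by (simp add: algebra_simps)
  moreover have "\<bar>ln S + \<epsilon> * a\<bar> \<le> ln (C + 1) + \<epsilon> * K"
    using hi lo by (simp add: algebra_simps abs_le_iff)
  ultimately show ?thesis
    unfolding S_def s_def[symmetric] t_def[symmetric] by (simp add: abs_mult)
qed

text \<open>The logarithm of the numerator counts twice and changes by at most \<open>M\<close>, and
  \<open>ln s\<close> changes by at most \<open>M\<close>, in total \<open>3 * M\<close>. This
  absorbs the error with which a prescribed height is attained.\<close>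

lemma hyperbolic_cone_dist_shift:
  assumes "d x y \<ge> 0" "s > 0" "s' > 0" "t > 0" "M \<ge> 0" "s \<le> exp M * s'" "s' \<le> exp M * s"
  shows "hyperbolic_cone_dist d (x, s) (y, t) \<le> hyperbolic_cone_dist d (x, s') (y, t) + 3 * M"
proof -
  have eq: "hyperbolic_cone_dist d (x, r) (y, t) = 2 * ln (d x y + max r t) - ln r - ln t"
    if "r > 0" for r
    using that assms by (simp add: hyperbolic_cone_dist_def ln_div ln_sqrt ln_mult add_nonneg_pos max_def field_simps)
  have M: "1 \<le> exp M" using assms by simp
  have "d x y + max s t \<le> exp M * (d x y + max s' t)"
  proof -
    have "d x y \<le> exp M * d x y" "t \<le> exp M * t"
      using M assms mult_right_mono[OF M] by fastforce+
    moreover have "exp M * s' \<le> exp M * max s' t" "exp M * t \<le> exp M * max s' t" by simp_all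
    ultimately show ?thesis using assms(6) unfolding distrib_left by linarith
  qed
  then have "ln (d x y + max s t) \<le> ln (exp M * (d x y + max s' t))"
    using assms by (intro ln_mono) (auto simp: add_nonneg_pos max_def)
  also have "\<dots> = M + ln (d x y + max s' t)"
    using assms by (subst ln_mult) (auto simp: add_nonneg_pos max_def add_nonneg_eq_0_iff)
  finally have 1: "ln (d x y + max s t) \<le> M + ln (d x y + max s' t)" .
  have "ln s' \<le> ln (exp M * s)" using assms by (intro ln_mono) auto
  also have "\<dots> = M + ln s" using assms by (simp add: ln_mult)
  finally show ?thesis using 1 assms by (simp add: eq)
qed

lemma exp_ereal_finite:
  assumes "P \<noteq> -\<infinity>" "\<epsilon> > 0"
  shows "\<exists>E\<ge>0. exp_ereal (- (ereal \<epsilon> * P)) = ereal E \<and> (P = \<infinity> \<longrightarrow> E = 0) \<and>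
    (\<forall>q. P = ereal q \<longrightarrow> E = exp (- (\<epsilon> * q)))"
proof (cases P)
  case (real r)
  then show ?thesis by (intro exI[of _ "exp (- (\<epsilon> * r))"]) (auto simp: exp_ereal_def)
next
  case PInf
  then show ?thesis
    using assms by (intro exI[of _ 0]) (auto simp: exp_ereal_def zero_ereal_def)
qed (use assms in auto)

section \<open>Cone distances of adapted points\<close>

context rough_horofunction
begin

lemma boundary_product_of_adapted:
  assumes "adapted K x z" "adapted K y z'" "K \<ge> 0"
    and z: "z \<in> \<zeta>" "\<And>u. u \<in> \<zeta> \<Longrightarrow> filterlim (\<lambda>i. product_wrt b (z i) (u i)) at_top sequentially"
    and z': "z' \<in> \<xi>" "\<And>u. u \<in> \<xi> \<Longrightarrow> filterlim (\<lambda>i. product_wrt b (z' i) (u i)) at_top sequentially"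
  shows "ereal (product_wrt b x y - (K + 5 * \<kappa>)) \<le> boundary_product_wrt b \<zeta> \<xi>"
    and "ereal r \<le> boundary_product_wrt b \<zeta> \<xi> \<Longrightarrow>
      min r (min (b x) (b y)) \<le> product_wrt b x y + (K + 5 * \<kappa>)"
proof -
  show "ereal (product_wrt b x y - (K + 5 * \<kappa>)) \<le> boundary_product_wrt b \<zeta> \<xi>"
    unfolding boundary_product_wrt_def
  proof (intro INF_greatest Liminf_bounded)
    fix u v assume "u \<in> \<zeta>" "v \<in> \<xi>"
    from product_le_of_adapted[OF assms(1-3) z(2)[OF this(1)] z'(2)[OF this(2)]]
    show "\<forall>\<^sub>F i in sequentially.
        ereal (product_wrt b x y - (K + 5 * \<kappa>)) \<le> ereal (product_wrt b (u i) (v i))"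
      by eventually_elim simp
  qed
  show "min r (min (b x) (b y)) \<le> product_wrt b x y + (K + 5 * \<kappa>)"
    if r: "ereal r \<le> boundary_product_wrt b \<zeta> \<xi>"
  proof (rule dense_le)
    \<comment> \<open>A lower bound on a liminf yields eventual bounds only strictly below it, so
      \<open>r\<close> is approached from below.\<close>
    fix e assume e: "e < min r (min (b x) (b y))"
    then have "ereal e < boundary_product_wrt b \<zeta> \<xi>"
      using r by (intro less_le_trans[OF _ r]) simp
    also have "\<dots> \<le> liminf (\<lambda>i. ereal (product_wrt b (z i) (z' i)))"
      unfolding boundary_product_wrt_def by (intro INF_lower2[OF z(1)] INF_lower z'(1))
    finally have "\<forall>\<^sub>F i in sequentially. e \<le> product_wrt b (z i) (z' i)"
      by (rule eventually_mono[OF less_LiminfD]) simp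
    from product_ge_of_adapted[OF assms(1-3) this] e \<kappa>_nonneg
    show "e \<le> product_wrt b x y + (K + 5 * \<kappa>)" by (simp add: min_def split: if_splits)
  qed
qed


text \<open>Stated for arbitrary adapted sequences, because one point may be adapted to several and
  two endpoints of the same point have to be compared later.\<close>

lemma cone_dist_of_adapted:
  assumes "adapted K x z" "adapted K y z'" "K \<ge> 0"
    and "z \<in> \<zeta>" "\<And>u. u \<in> \<zeta> \<Longrightarrow> filterlim (\<lambda>i. product_wrt b (z i) (u i)) at_top sequentially"
    and "z' \<in> \<xi>" "\<And>u. u \<in> \<xi> \<Longrightarrow> filterlim (\<lambda>i. product_wrt b (z' i) (u i)) at_top sequentially"
    and \<epsilon>: "\<epsilon> > 0" and C: "C \<ge> 1"
    and d: "ereal (inverse C) * exp_ereal (- (ereal \<epsilon> * boundary_product_wrt b \<zeta> \<xi>)) \<le> ereal (d \<zeta> \<xi>)"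
      "ereal (d \<zeta> \<xi>) \<le> ereal C * exp_ereal (- (ereal \<epsilon> * boundary_product_wrt b \<zeta> \<xi>))"
  shows "\<bar>hyperbolic_cone_dist d (\<zeta>, exp (- (\<epsilon> * b x))) (\<xi>, exp (- (\<epsilon> * b y))) - \<epsilon> * dist x y\<bar>
    \<le> 2 * (ln (C + 1) + \<epsilon> * (K + 5 * \<kappa>))"
proof -
  let ?P = "boundary_product_wrt b \<zeta> \<xi>" and ?K = "K + 5 * \<kappa>" and ?a = "product_wrt b x y"
  note P = boundary_product_of_adapted[OF assms(1-7)]
  have P_finite: "?P \<noteq> -\<infinity>" using P(1) by auto
  obtain E where E: "exp_ereal (- (ereal \<epsilon> * ?P)) = ereal E" "E \<ge> 0"
    "?P = \<infinity> \<Longrightarrow> E = 0" "\<And>q. ?P = ereal q \<Longrightarrow> E = exp (- (\<epsilon> * q))"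
    using exp_ereal_finite[OF P_finite \<epsilon>] by blast
  have "inverse C * E \<le> d \<zeta> \<xi>" "d \<zeta> \<xi> \<le> C * E"
    using d unfolding E(1) by simp_all
  then have dE: "E \<le> C * d \<zeta> \<xi>" "d \<zeta> \<xi> \<le> C * E"
    using C by (simp_all add: field_simps)
  have "E \<le> exp (- (\<epsilon> * (?a - ?K))) \<and>
      exp (- (\<epsilon> * (?a + ?K))) \<le> max E (max (exp (- (\<epsilon> * b x))) (exp (- (\<epsilon> * b y))))"
  proof (cases ?P)
    case (real q)
    have "?a - ?K \<le> q" using P(1) real by simp
    moreover have "min q (min (b x) (b y)) \<le> ?a + ?K" using P(2)[of q] real by simp
    ultimately show ?thesis
      using E(4)[OF real] \<epsilon> by (auto simp: min_def le_max_iff_disj split: if_splits)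
  next
    case PInf
    \<comment> \<open>With an infinite product any real \<open>r\<close> is allowed; this choice
      reduces the minimum to that of the heights.\<close>
    have "min (max (b x) (b y)) (min (b x) (b y)) \<le> ?a + ?K" using P(2)[of "max (b x) (b y)"] PInf by simp
    then show ?thesis
      using E(3)[OF PInf] \<epsilon> by (auto simp: min_def max_def le_max_iff_disj split: if_splits)
  qed (use P_finite in simp)
  moreover have "?a \<le> b x + ?K" "?a \<le> b y + ?K"
    using product_le[of x y] \<open>K \<ge> 0\<close> \<kappa>_nonneg by simp_all
  ultimately have "\<bar>2 * ln ((d \<zeta> \<xi> + max (exp (- (\<epsilon> * b x))) (exp (- (\<epsilon> * b y)))) /
      sqrt (exp (- (\<epsilon> * b x)) * exp (- (\<epsilon> * b y)))) - \<epsilon> * (b x + b y - 2 * ?a)\<bar>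
      \<le> 2 * (ln (C + 1) + \<epsilon> * ?K)"
    using \<kappa>_nonneg \<open>K \<ge> 0\<close>
    by (intro cone_dist_estimate[OF \<epsilon> C _ E(2) _ _ dE]) auto
  moreover have "b x + b y - 2 * ?a = dist x y"
    by (simp add: product_wrt_def field_simps)
  ultimately show ?thesis
    by (simp add: hyperbolic_cone_dist_def)
qed

end

theorem theorem1p3:
  fixes \<omega> :: "(nat \<Rightarrow> 'a::metric_space) set"
    and \<epsilon> :: real
    and d :: "(nat \<Rightarrow> 'a) set \<Rightarrow> (nat \<Rightarrow> 'a) set \<Rightarrow> real"
  assumes "gromov_hyperbolic TYPE('a)"
    and "visual_space TYPE('a)"
    and "\<omega> \<in> gromov_boundary"
    and "\<epsilon> > 0"
    and "visual_metric \<omega> \<epsilon> d"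
    and "\<exists>\<zeta>1\<in>relative_boundary \<omega>. \<exists>\<zeta>2\<in>relative_boundary \<omega>. \<exists>\<zeta>3\<in>relative_boundary \<omega>.
           \<zeta>1 \<noteq> \<zeta>2 \<and> \<zeta>1 \<noteq> \<zeta>3 \<and> \<zeta>2 \<noteq> \<zeta>3"
  shows "roughly_similar (UNIV :: 'a set) dist (hyperbolic_cone (relative_boundary \<omega>)) (hyperbolic_cone_dist d)"
proof -
  obtain \<delta> where \<delta>: "\<delta> \<ge> 0" and hyp: "\<And>x y z p :: 'a.
      gromov_product p x y \<ge> min (gromov_product p x z) (gromov_product p z y) - \<delta>"
    using assms(1) unfolding gromov_hyperbolic_def by blast
  obtain k and p :: 'a where k: "k \<ge> 0"
    and ray: "\<And>x. \<exists>\<gamma>. roughly_geodesic_ray k p \<gamma> \<and> x \<in> \<gamma> ` {0..}"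
    using assms(2) unfolding visual_space_def by blast
  obtain w where \<omega>: "\<omega> = boundary_equiv `` {w}" and w: "converges_to_infinity w"
    using assms(3) unfolding gromov_boundary_def by (auto elim: quotientE)
  obtain b C where metric: "Metric_space (relative_boundary \<omega>) d"
    and b: "b \<in> busemann_functions \<omega>" and C: "C \<ge> 1"
    and d: "\<And>\<zeta> \<xi>. \<zeta> \<in> relative_boundary \<omega> \<Longrightarrow> \<xi> \<in> relative_boundary \<omega> \<Longrightarrow>
        ereal (inverse C) * exp_ereal (- (ereal \<epsilon> * boundary_product_wrt b \<zeta> \<xi>)) \<le> ereal (d \<zeta> \<xi>)"
      "\<And>\<zeta> \<xi>. \<zeta> \<in> relative_boundary \<omega> \<Longrightarrow> \<xi> \<in> relative_boundary \<omega> \<Longrightarrow>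
        ereal (d \<zeta> \<xi>) \<le> ereal C * exp_ereal (- (ereal \<epsilon> * boundary_product_wrt b \<zeta> \<xi>))"
    using assms(5) unfolding visual_metric_def by blast
  obtain \<kappa> where "rough_horofunction p b \<kappa>"
    using rough_horofunction_busemann[OF \<delta> hyp k ray \<omega> w b] .
  then interpret rough_horofunction p b \<kappa> .
  define cls where "cls z = relative_boundary_equiv \<omega> `` {z}" for z
  have conv_iff: "converges_to_infinity_wrt \<omega> z \<longleftrightarrow> conv z" for z
    unfolding conv_def by (rule converges_to_infinity_wrt_iff[OF hyp \<omega> w b])
  have boundary: "relative_boundary \<omega> = cls ` {z. conv z}"
    unfolding relative_boundary_def quotient_def cls_def conv_iff by auto
  have cls_self: "z \<in> cls z" if "conv z" for z
    using relative_boundary_equiv_self[of \<omega> z] that unfolding cls_def conv_iff by blast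
  have cls_lim: "filterlim (\<lambda>i. product_wrt b (z i) (u i)) at_top sequentially" if "u \<in> cls z" for u z
    using that b unfolding cls_def relative_boundary_equiv_def by blast
  obtain z0 where "conv z0" using assms(6) unfolding boundary by blast
  then obtain K0 Z where K0: "K0 \<ge> 0" and Z: "\<And>x. adapted K0 x (Z x)"
    using exists_adapted_sequence by metis
  \<comment> \<open>One constant for both the chosen sequences \<open>Z x\<close> and the lines
    through prescribed cone points, so that \<open>cone\<close> can compare them.\<close>
  define K where "K = max K0 (30 * \<kappa>)"
  have K: "K \<ge> 0" "\<And>x z. adapted K0 x z \<Longrightarrow> adapted K x z" "\<And>x z. adapted (30 * \<kappa>) x z \<Longrightarrow> adapted K x z"
    using K0 unfolding K_def adapted_def by (auto elim!: eventually_mono)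
  define L where "L = 2 * (ln (C + 1) + \<epsilon> * (K + 5 * \<kappa>))"
  have L: "L \<ge> 0"
    using C K(1) \<kappa>_nonneg assms(4) unfolding L_def by simp
  have conv: "conv z" if "adapted K x z" for x z
    using that unfolding adapted_def by blast
  have cone: "\<bar>hyperbolic_cone_dist d (cls z, exp (- (\<epsilon> * b x))) (cls z', exp (- (\<epsilon> * b y))) - \<epsilon> * dist x y\<bar> \<le> L"
    if "adapted K x z" "adapted K y z'" for x y z z'
    unfolding L_def using conv[OF that(1)] conv[OF that(2)] boundary
    by (intro cone_dist_of_adapted[OF that K(1) cls_self cls_lim cls_self cls_lim assms(4) C] d) auto
  define g where "g x = (cls (Z x), exp (- (\<epsilon> * b x)))" for x
  show ?thesis
    unfolding roughly_similar_def
  \<comment> \<open>The summand \<open>60 * \<kappa> * \<epsilon>\<close> is \<open>3 * M\<close> of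
    \<open>hyperbolic_cone_dist_shift\<close> with
    \<open>M = \<epsilon> * (20 * \<kappa>)\<close>.\<close>
  proof (rule exI[of _ \<epsilon>], intro conjI exI[of _ "L + 60 * \<kappa> * \<epsilon>"] bexI[of _ g] ballI)
    show "\<epsilon> > 0" by fact
    have \<kappa>\<epsilon>: "\<kappa> * \<epsilon> \<ge> 0" using \<kappa>_nonneg assms(4) by simp
    then show "L + 60 * \<kappa> * \<epsilon> \<ge> 0" using L by simp
    show "g \<in> UNIV \<rightarrow> hyperbolic_cone (relative_boundary \<omega>)"
      using conv[OF K(2)[OF Z]] unfolding g_def hyperbolic_cone_def boundary by auto
    fix x y
    show "\<epsilon> * dist x y - (L + 60 * \<kappa> * \<epsilon>) \<le> hyperbolic_cone_dist d (g x) (g y)"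
      and "hyperbolic_cone_dist d (g x) (g y) \<le> \<epsilon> * dist x y + (L + 60 * \<kappa> * \<epsilon>)"
      using cone[OF K(2)[OF Z] K(2)[OF Z], of x y] \<kappa>\<epsilon> unfolding g_def by (auto simp: abs_le_iff)
  next
    fix y assume "y \<in> hyperbolic_cone (relative_boundary \<omega>)"
    then obtain z s where y: "y = (cls z, s)" and z: "conv z" and s: "s > 0"
      unfolding hyperbolic_cone_def boundary by auto
    define h where "h = - ln s / \<epsilon>"
    obtain u where u: "\<bar>b u - h\<bar> \<le> 20 * \<kappa>" "adapted (30 * \<kappa>) u z"
      using exists_adapted_point[OF z] .
    let ?s = "exp (- (\<epsilon> * b u))" and ?M = "\<epsilon> * (20 * \<kappa>)"
    have s_eq: "s = exp (- (\<epsilon> * h))" using s assms(4) by (simp add: h_def)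
    have "\<bar>\<epsilon> * b u - \<epsilon> * h\<bar> \<le> ?M"
      using mult_left_mono[OF u(1), of \<epsilon>] assms(4) by (simp add: abs_mult flip: right_diff_distrib)
    then have "s \<le> exp ?M * ?s" "?s \<le> exp ?M * s"
      unfolding s_eq exp_add[symmetric] by (simp_all add: abs_le_iff)
    then have "hyperbolic_cone_dist d y (g u) \<le> hyperbolic_cone_dist d (cls z, ?s) (g u) + 3 * ?M"
      unfolding y g_def using s \<kappa>_nonneg assms(4) Metric_space.nonneg[OF metric]
      by (intro hyperbolic_cone_dist_shift) auto
    \<comment> \<open>The point \<open>u\<close> is compared with itself: \<open>z\<close> and
      \<open>Z u\<close> may have different limits, but both are adapted to \<open>u\<close>, and
      \<open>dist u u = 0\<close>.\<close>
    also have "hyperbolic_cone_dist d (cls z, ?s) (g u) \<le> L"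
      using cone[OF K(3)[OF u(2)] K(2)[OF Z[of u]]] unfolding g_def by (simp add: abs_le_iff)
    finally show "\<exists>x\<in>UNIV. hyperbolic_cone_dist d y (g x) \<le> L + 60 * \<kappa> * \<epsilon>"
      by (intro bexI[of _ u]) (auto simp: algebra_simps)
  qed
qed

end
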